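(* Let $P\in\mathbb{C}[X]$ be a polynomial such that $$P(0)=0,\qquad P'(0)\ne0,\qquad\text{and}\qquad \forall x\in\,]0,4],\ P(x)\neq0.$$ Then the sequence of matrices $(P(\mathbf{A}_N))_{N\ge1}$ is strongly stable.
   Context: For $N\ge1$, $h=\frac1{N+1}$ and $\mathbf{A}_N\in\mathbb{C}^{N\times N}$ is the tridiagonal matrix with diagonal entries $2$ and sub- and super-diagonal entries $-1$ (all other entries $0$). A sequence $(\mathbf{D}_N)_{N\ge1}$, $\mathbf{D}_N\in\mathbb{C}^{N\times N}$, is strongly stable if for every $r\in\mathbb{N}=\{0,1,2,\dots\}$ there is $c>0$ such that for all $N\ge1$ and all $\mathbf{v}\in\mathbb{C}^N$, $c\|\mathbf{v}\|_\infty\le\max_{1\le j\le N}\omega_j|(\mathbf{D}_N\mathbf{v})_j|$, where $\omega_j=h^{-2}$ if $r<j<N+1-r$ and $\omega_j=1$ otherwise. *)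

theory Defs
  imports Complex_Main "HOL-Computational_Algebra.Polynomial" "Jordan_Normal_Form.Matrix"
begin

definition mesh_width :: "nat \<Rightarrow> real" where
  "mesh_width N = 1 / (real N + 1)"

definition A_mat :: "nat \<Rightarrow> complex mat" where
  "A_mat N = mat N N (\<lambda>(i, j). if i = j then 2 else if i = Suc j \<or> j = Suc i then -1 else 0)"

text \<open>The matrix \<open>P(A)\<close>, i.e. the sum of \<open>coeff P k \<cdot>\<^sub>m (A ^\<^sub>m k)\<close> over \<open>k \<le> degree P\<close>,
  for square \<open>A\<close>. The sum is written entrywise because \<open>mat\<close>, which carries its dimensions as
  values, has no zero usable by \<open>sum\<close>.\<close>

definition poly_mat :: "'a :: comm_semiring_1 poly \<Rightarrow> 'a mat \<Rightarrow> 'a mat" where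
  "poly_mat P A = mat (dim_row A) (dim_row A)
     (\<lambda>(i, j). \<Sum>k\<le>degree P. (coeff P k \<cdot>\<^sub>m (A ^\<^sub>m k)) $$ (i, j))"

text \<open>Only used for vectors of positive dimension (\<open>Max {}\<close> is unspecified).\<close>

definition sup_norm_vec :: "complex vec \<Rightarrow> real" where
  "sup_norm_vec v = Max ((\<lambda>i. cmod (v $ i)) ` {0..<dim_vec v})"

text \<open>Here \<open>1 \<le> j \<le> N\<close>. If \<open>r > N + 1\<close>, the truncated difference is \<open>0\<close>, so that the first case
  is empty, just as with integer subtraction.\<close>

definition weight :: "nat \<Rightarrow> nat \<Rightarrow> nat \<Rightarrow> real" where
  "weight N r j = (if r < j \<and> j < N + 1 - r then mesh_width N powi (-2) else 1)"

text \<open>The mathematical index \<open>j\<close> runs over \<open>1, \<dots>, N\<close>, whereas \<open>vec\<close> counts components from \<open>0\<close>.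
  The value \<open>D 0\<close> is irrelevant.\<close>

definition strongly_stable :: "(nat \<Rightarrow> complex mat) \<Rightarrow> bool" where
  "strongly_stable D \<longleftrightarrow>
     (\<forall>N\<ge>1. D N \<in> carrier_mat N N) \<and>
     (\<forall>r::nat. \<exists>c>0. \<forall>N\<ge>1. \<forall>v \<in> carrier_vec N.
        c * sup_norm_vec v \<le> Max ((\<lambda>j. weight N r j * cmod ((D N *\<^sub>v v) $ (j - 1))) ` {1..N}))"

end

theory Submission
  imports Defs "HOL-Computational_Algebra.Fundamental_Theorem_Algebra"
begin

text \<open>
  Write \<open>P = X Q\<close>. The hypotheses say that \<open>Q\<close> has no zero on the closed interval \<open>[0, 4]\<close>, which
  contains the spectra of all the matrices \<open>A\<^sub>N\<close>, and \<open>P(A\<^sub>N) = A\<^sub>N Q(A\<^sub>N)\<close>. The two factors are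
  inverted separately.

  The factor \<open>Q(A\<^sub>N)\<close> has an inverse that is bounded in the sup norm uniformly in \<open>N\<close>
  (\<open>poly_mat_inverse_bound\<close>). Over the complex numbers it suffices to treat a linear factor \<open>X - z\<close>
  with \<open>z \<notin> [0, 4]\<close>. Writing \<open>2 - z = w + 1/w\<close> with \<open>0 < \<bar>w\<bar> < 1\<close>, the second-order recurrence given by
  \<open>A\<^sub>N - z\<close> splits into first-order recurrences with the contracting ratio \<open>w\<close>
  (\<open>second_difference_resolvent_bound\<close>).

  It remains to bound the solution of \<open>A\<^sub>N y = f\<close> when the entries of \<open>f\<close> are at most \<open>M h\<^sup>2\<close>, except
  that the \<open>r\<close> entries next to either end may be as large as \<open>M\<close>. The discrete Laplacian obeys a
  minimum principle, so an explicit supersolution is enough: a quadratic one absorbs \<open>h\<^sup>2\<close>, and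
  \<open>1 - 2\<^sup>-\<^sup>j\<close> with its mirror image absorbs the entries at the ends (\<open>discrete_Laplacian_bound\<close>).
  Both are bounded independently of \<open>N\<close>. Hence \<open>y = Q(A\<^sub>N) v\<close>, and then \<open>v\<close> itself, is bounded by a
  constant times \<open>M\<close>.
\<close>

section \<open>Second differences with zero boundary values\<close>

text \<open>Extending by zero at the indices \<open>0\<close> and \<open>N + 1\<close> removes the special role of the first and last
  rows of \<open>A_mat N\<close>.\<close>

definition padded :: "complex vec \<Rightarrow> nat \<Rightarrow> complex" where
  "padded v j = (if 1 \<le> j \<and> j \<le> dim_vec v then v $ (j - 1) else 0)"

lemma padded_Suc: "i < dim_vec v \<Longrightarrow> padded v (Suc i) = v $ i"
  by (simp add: padded_def)

lemma A_mat_carrier [simp]: "A_mat N \<in> carrier_mat N N"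
  by (simp add: A_mat_def)

lemma A_mat_mult_vec:
  assumes v: "v \<in> carrier_vec N" and i: "i < N"
  shows "(A_mat N *\<^sub>v v) $ i = 2 * padded v (Suc i) - padded v i - padded v (Suc (Suc i))"
proof -
  have "(A_mat N *\<^sub>v v) $ i = (\<Sum>k<N. A_mat N $$ (i, k) * v $ k)"
    using v i by (auto simp: A_mat_def scalar_prod_def atLeast0LessThan intro!: sum.cong)
  also have "\<dots> = (\<Sum>k<N. (if k = i then 2 * v $ k else 0)
      - (if Suc k = i then v $ k else 0) - (if k = Suc i then v $ k else 0))"
    using i by (intro sum.cong) (auto simp: A_mat_def)
  also have "\<dots> = (\<Sum>k<N. if k = i then 2 * v $ k else 0)
      - (\<Sum>k<N. if Suc k = i then v $ k else 0) - (\<Sum>k<N. if k = Suc i then v $ k else 0)"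
    by (simp add: sum_subtractf)
  also have "(\<Sum>k<N. if k = i then 2 * v $ k else 0) = 2 * padded v (Suc i)"
    using v i by (simp add: padded_def)
  also have "(\<Sum>k<N. if Suc k = i then v $ k else 0) = padded v i"
    using v i by (cases i) (simp_all add: padded_def)
  also have "(\<Sum>k<N. if k = Suc i then v $ k else 0) = padded v (Suc (Suc i))"
    using v i by (simp add: padded_def)
  finally show ?thesis .
qed

section \<open>The shifted second difference\<close>

text \<open>The roots of \<open>X\<^sup>2 - (2 - z) X + 1\<close> have product \<open>1\<close>, so one of them lies inside the unit disc
  unless both lie on the circle. In that case they are conjugate, and their sum \<open>2 - z\<close> is a real
  number of modulus at most \<open>2\<close>, which puts \<open>z\<close> in \<open>[0, 4]\<close>.\<close>

lemma joukowski_parameter: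
  fixes z :: complex
  assumes "\<forall>x::real \<in> {0..4}. z \<noteq> complex_of_real x"
  obtains w where "w \<noteq> 0" "cmod w < 1" "z = 2 - (w + 1 / w)"
proof -
  define s where "s = csqrt ((2 - z)\<^sup>2 - 4)"
  define w where "w = (2 - z + s) / 2"
  define w' where "w' = (2 - z - s) / 2"
  have s2: "s\<^sup>2 = (2 - z)\<^sup>2 - 4" unfolding s_def by simp
  have prod: "w * w' = 1"
    using s2 by (simp add: w_def w'_def field_simps power2_eq_square)
  have sum: "w + w' = 2 - z" by (simp add: w_def w'_def field_simps)
  have nz: "w \<noteq> 0" "w' \<noteq> 0" using prod by auto
  have inv: "w' = 1 / w" "w = 1 / w'" using prod nz by (simp_all add: field_simps)
  have z: "z = 2 - (w + 1 / w)" "z = 2 - (w' + 1 / w')"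
    unfolding inv(1) [symmetric] inv(2) [symmetric] add.commute [of w' w] sum by simp_all
  have not1: "cmod w \<noteq> 1"
  proof
    assume w1: "cmod w = 1"
    have "w * cnj w = 1" using w1 by (simp add: complex_norm_square [symmetric])
    then have "w' = cnj w" using prod nz by (metis mult_left_cancel)
    then have "z = complex_of_real (2 - 2 * Re w)"
      using sum by (simp add: complex_add_cnj algebra_simps)
    moreover have "\<bar>Re w\<bar> \<le> 1" using abs_Re_le_cmod [of w] w1 by simp
    ultimately show False using assms [rule_format, of "2 - 2 * Re w"] by (simp add: abs_le_iff)
  qed
  show thesis
  proof (cases "cmod w < 1")
    case True
    show thesis by (rule that [OF nz(1) True z(1)])
  next
    case False
    then have "cmod w > 1" using not1 by simp
    moreover have "cmod w' = 1 / cmod w" unfolding inv(1) by (simp add: norm_divide)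
    ultimately have "cmod w' < 1" by (simp add: divide_less_eq)
    show thesis by (rule that [OF nz(2) \<open>cmod w' < 1\<close> z(2)])
  qed
qed

text \<open>With \<open>f\<close> for the shifted second difference of \<open>x\<close>, the combination
  \<open>u\<^sub>j = x\<^sub>j - w x\<^sub>j\<^sub>-\<^sub>1\<close> satisfies \<open>u\<^sub>j = w (u\<^sub>j\<^sub>+\<^sub>1 + f\<^sub>j)\<close>, and its mirror image
  \<open>u'\<^sub>j = x\<^sub>j\<^sub>-\<^sub>1 - w x\<^sub>j\<close> satisfies \<open>u'\<^sub>j\<^sub>+\<^sub>1 = w (u'\<^sub>j + f\<^sub>j)\<close>. Neither recurrence has a starting value of
  its own, but the zero boundary values turn the end of each into the start of the other:
  \<open>u\<^sub>n = - w u'\<^sub>n\<close> and \<open>u'\<^sub>1 = - w u\<^sub>1\<close>. So the maximum \<open>U\<close> of both families satisfies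
  \<open>U \<le> \<bar>w\<bar> (U + F)\<close>. The factor \<open>1 - \<bar>w\<bar>\<close> appears a second time when \<open>x\<close> is recovered from \<open>u\<close>.\<close>

lemma second_difference_resolvent_bound:
  fixes x :: "nat \<Rightarrow> complex"
  assumes w: "w \<noteq> 0" "cmod w < 1" and n: "n \<ge> 1" and bdry: "x 0 = 0" "x n = 0"
    and F: "\<And>j. 1 \<le> j \<Longrightarrow> j < n \<Longrightarrow> cmod ((w + 1 / w) * x j - x (j - 1) - x (j + 1)) \<le> F"
    and F0: "F \<ge> 0" and j: "j \<le> n"
  shows "cmod (x j) \<le> F / (1 - cmod w)\<^sup>2"
proof -
  define f where "f j = (w + 1 / w) * x j - x (j - 1) - x (j + 1)" for j
  define u where "u j = x j - w * x (j - 1)" for j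
  define u' where "u' j = x (j - 1) - w * x j" for j
  define U where "U = Max ((\<lambda>j. max (cmod (u j)) (cmod (u' j))) ` {1..n})"
  define q where "q = cmod w"
  have q: "q < 1" "0 \<le> q" using w by (auto simp: q_def)
  have U: "cmod (u j) \<le> U" "cmod (u' j) \<le> U" if "1 \<le> j" "j \<le> n" for j
  proof -
    have "max (cmod (u j)) (cmod (u' j)) \<le> U"
      unfolding U_def using that by (intro Max_ge) auto
    then show "cmod (u j) \<le> U" "cmod (u' j) \<le> U" by auto
  qed
  have U0: "U \<ge> 0" using U(1) [of 1] n norm_ge_zero order_trans by blast
  have scaled: "cmod (w * (a + b)) \<le> q * (U + F)" if "cmod a \<le> U" "cmod b \<le> F" for a b
    unfolding norm_mult q_def using that norm_triangle_mono by (intro mult_left_mono) auto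
  have u_step: "u j = w * (u (j + 1) + f j)" if "1 \<le> j" for j
    using w that by (simp add: u_def f_def field_simps)
  have u'_step: "u' (j + 1) = w * (u' j + f j)" if "1 \<le> j" for j
    using w that by (simp add: u'_def f_def field_simps)
  have contraction: "cmod (u j) \<le> q * (U + F)" "cmod (u' j) \<le> q * (U + F)"
    if j: "1 \<le> j" "j \<le> n" for j
  proof -
    show "cmod (u j) \<le> q * (U + F)"
    proof (cases "j = n")
      case True
      then have "u j = w * (- u' n + 0)" using bdry by (simp add: u_def u'_def)
      then show ?thesis using scaled [of "- u' n" 0] U(2) [of n] n F0 by simp
    next
      case False
      then show ?thesis
        unfolding u_step [OF j(1)] using j F [of j] by (intro scaled U) (auto simp: f_def)
    qed
    show "cmod (u' j) \<le> q * (U + F)"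
    proof (cases "j = 1")
      case True
      then have "u' j = w * (- u 1 + 0)" using bdry by (simp add: u_def u'_def)
      then show ?thesis using scaled [of "- u 1" 0] U(1) [of 1] n F0 by simp
    next
      case False
      define i where "i = j - 1"
      have i: "j = i + 1" "1 \<le> i" "i < n" using False j by (auto simp: i_def)
      show ?thesis
        unfolding i(1) u'_step [OF i(2)] using i F [of i] by (intro scaled U) (auto simp: f_def)
    qed
  qed
  have "U \<le> q * (U + F)"
    unfolding U_def using n contraction by (subst Max_le_iff) (auto simp: U_def)
  then have "U * (1 - q) \<le> q * F" by (simp add: algebra_simps)
  also have "\<dots> \<le> F" using q F0 by (intro mult_left_le_one_le) auto
  finally have UF: "U \<le> F / (1 - q)" using q by (simp add: field_simps)
  have xU: "cmod (x j) \<le> U / (1 - q)" if "j \<le> n" for j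
    using that
  proof (induction j)
    case 0
    then show ?case using bdry U0 q by simp
  next
    case (Suc j)
    have "x (Suc j) = w * x j + u (Suc j)" by (simp add: u_def)
    then have "cmod (x (Suc j)) \<le> q * cmod (x j) + cmod (u (Suc j))"
      unfolding q_def by (metis norm_mult norm_triangle_ineq)
    also have "\<dots> \<le> q * (U / (1 - q)) + U"
      using Suc U(1) [of "Suc j"] q by (intro add_mono mult_left_mono) auto
    also have "\<dots> = U / (1 - q)" using q by (simp add: field_simps)
    finally show ?case .
  qed
  have "cmod (x j) \<le> U / (1 - q)" using xU j by blast
  also have "\<dots> \<le> (F / (1 - q)) / (1 - q)" using UF q by (intro divide_right_mono) auto
  finally show ?thesis by (simp add: q_def power2_eq_square)
qed

section \<open>Inverting a polynomial of the matrix\<close>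

lemma pow_mat_Suc_left:
  assumes A: "(A :: 'a :: comm_semiring_1 mat) \<in> carrier_mat n n"
  shows "A ^\<^sub>m Suc k = A * A ^\<^sub>m k"
proof (induction k)
  case 0
  then show ?case using A by simp
next
  case (Suc k)
  have "A ^\<^sub>m Suc (Suc k) = (A * A ^\<^sub>m k) * A" using Suc by simp
  also have "\<dots> = A * (A ^\<^sub>m k * A)"
    using A by (intro assoc_mult_mat [of _ n n _ n _ n] pow_carrier_mat) auto
  finally show ?case by simp
qed

lemma poly_mat_carrier:
  "A \<in> carrier_mat n n \<Longrightarrow> poly_mat p A \<in> carrier_mat n n"
  by (simp add: poly_mat_def)

text \<open>The summation bound is left free so that the polynomials \<open>p\<close> and \<open>[:a, 1:] * p\<close>, of different
  degree, can be expanded over a common range.\<close>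

lemma poly_mat_entry:
  assumes A: "A \<in> carrier_mat n n" and m: "degree p \<le> m" and ij: "i < n" "j < n"
  shows "poly_mat p A $$ (i, j) = (\<Sum>k\<le>m. coeff p k * (A ^\<^sub>m k) $$ (i, j))"
proof -
  have idx: "(c \<cdot>\<^sub>m (A ^\<^sub>m k)) $$ (i, j) = c * (A ^\<^sub>m k) $$ (i, j)" for c k
    using carrier_matD [OF pow_carrier_mat [OF A, of k]] ij by (subst index_smult_mat) auto
  have "poly_mat p A $$ (i, j) = (\<Sum>k\<le>degree p. coeff p k * (A ^\<^sub>m k) $$ (i, j))"
    using A ij idx by (simp add: poly_mat_def)
  also have "\<dots> = (\<Sum>k\<le>m. coeff p k * (A ^\<^sub>m k) $$ (i, j))"
    using m by (intro sum.mono_neutral_left) (auto simp: coeff_eq_0)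
  finally show ?thesis .
qed

lemma poly_mat_linear_mult:
  fixes A :: "'a :: comm_ring_1 mat"
  assumes A: "A \<in> carrier_mat n n"
  shows "poly_mat ([:a, 1:] * p) A = A * poly_mat p A + a \<cdot>\<^sub>m poly_mat p A"
proof (rule eq_matI)
  have cA: "poly_mat p A \<in> carrier_mat n n" for p using A by (rule poly_mat_carrier)
  show "dim_row (poly_mat ([:a, 1:] * p) A) = dim_row (A * poly_mat p A + a \<cdot>\<^sub>m poly_mat p A)"
    "dim_col (poly_mat ([:a, 1:] * p) A) = dim_col (A * poly_mat p A + a \<cdot>\<^sub>m poly_mat p A)"
    using A cA by (auto simp: poly_mat_def)
  fix i j
  assume "i < dim_row (A * poly_mat p A + a \<cdot>\<^sub>m poly_mat p A)"
    "j < dim_col (A * poly_mat p A + a \<cdot>\<^sub>m poly_mat p A)"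
  then have ij: "i < n" "j < n" using A cA [of p] by (auto simp: poly_mat_def)
  define m where "m = degree p"
  have deg: "degree ([:a, 1:] * p) \<le> Suc m"
    using degree_mult_le [of "[:a, 1:]" p] by (auto simp: m_def intro: order_trans)
  have "poly_mat ([:a, 1:] * p) A $$ (i, j)
      = (\<Sum>k\<le>Suc m. coeff ([:a, 1:] * p) k * (A ^\<^sub>m k) $$ (i, j))"
    by (rule poly_mat_entry [OF A deg ij])
  also have "\<dots> = (\<Sum>k\<le>Suc m. coeff (pCons 0 p) k * (A ^\<^sub>m k) $$ (i, j))
      + a * (\<Sum>k\<le>Suc m. coeff p k * (A ^\<^sub>m k) $$ (i, j))"
    by (simp add: algebra_simps sum.distrib sum_distrib_left del: sum.atMost_Suc)
  also have "(\<Sum>k\<le>Suc m. coeff p k * (A ^\<^sub>m k) $$ (i, j)) = poly_mat p A $$ (i, j)"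
    using poly_mat_entry [OF A _ ij, of p "Suc m"] by (simp add: m_def)
  also have "(\<Sum>k\<le>Suc m. coeff (pCons 0 p) k * (A ^\<^sub>m k) $$ (i, j))
      = (\<Sum>k\<le>m. coeff p k * (A ^\<^sub>m Suc k) $$ (i, j))"
    by (subst sum.atMost_Suc_shift) simp
  also have "\<dots> = (\<Sum>k\<le>m. coeff p k * (\<Sum>l<n. A $$ (i, l) * (A ^\<^sub>m k) $$ (l, j)))"
  proof (intro sum.cong refl arg_cong2 [where f = "(*)"])
    fix k
    show "(A ^\<^sub>m Suc k) $$ (i, j) = (\<Sum>l<n. A $$ (i, l) * (A ^\<^sub>m k) $$ (l, j))"
      unfolding pow_mat_Suc_left [OF A] using A pow_carrier_mat [OF A, of k] ij
      by (auto simp: scalar_prod_def atLeast0LessThan intro!: sum.cong)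
  qed
  also have "\<dots> = (\<Sum>l<n. A $$ (i, l) * (\<Sum>k\<le>m. coeff p k * (A ^\<^sub>m k) $$ (l, j)))"
    by (simp add: sum_distrib_left) (subst sum.swap, simp add: ac_simps)
  also have "\<dots> = (\<Sum>l<n. A $$ (i, l) * poly_mat p A $$ (l, j))"
    using poly_mat_entry [OF A _ _ ij(2), of p m] by (intro sum.cong) (auto simp: m_def)
  also have "\<dots> = (A * poly_mat p A) $$ (i, j)"
    using A cA [of p] ij by (auto simp: scalar_prod_def atLeast0LessThan intro!: sum.cong)
  finally show "poly_mat ([:a, 1:] * p) A $$ (i, j)
      = (A * poly_mat p A + a \<cdot>\<^sub>m poly_mat p A) $$ (i, j)"
    using A cA [of p] ij by simp
qed

lemma poly_mat_linear_mult_vec: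
  fixes A :: "'a :: comm_ring_1 mat"
  assumes A: "A \<in> carrier_mat n n" and v: "v \<in> carrier_vec n"
  shows "poly_mat ([:a, 1:] * p) A *\<^sub>v v
    = A *\<^sub>v (poly_mat p A *\<^sub>v v) + a \<cdot>\<^sub>v (poly_mat p A *\<^sub>v v)"
proof -
  have cA: "poly_mat p A \<in> carrier_mat n n" using A by (rule poly_mat_carrier)
  show ?thesis
    unfolding poly_mat_linear_mult [OF A]
    using A v cA
    by (subst add_mult_distrib_mat_vec [of _ n n])
      (auto simp: assoc_mult_mat_vec [of _ n n _ n] intro!: eq_vecI)
qed

text \<open>The bound is phrased for a solution \<open>v\<close> of the linear system, so that neither invertibility of
  \<open>A\<^sub>N - z\<close> nor an operator norm has to be introduced.\<close>

lemma resolvent_bound: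
  assumes "\<forall>x::real \<in> {0..4}. z \<noteq> complex_of_real x"
  obtains C where "C > 0"
    "\<And>N v F. v \<in> carrier_vec N \<Longrightarrow> F \<ge> 0 \<Longrightarrow>
       (\<forall>i<N. cmod ((A_mat N *\<^sub>v v + (- z) \<cdot>\<^sub>v v) $ i) \<le> F) \<Longrightarrow> (\<forall>i<N. cmod (v $ i) \<le> C * F)"
proof -
  obtain w where w: "w \<noteq> 0" "cmod w < 1" and z: "z = 2 - (w + 1 / w)"
    using joukowski_parameter [OF assms] .
  show thesis
  proof (rule that [of "1 / (1 - cmod w)\<^sup>2"])
    show "1 / (1 - cmod w)\<^sup>2 > 0" using w by simp
    fix N v and F :: real
    assume v: "v \<in> carrier_vec N" and F0: "F \<ge> 0"
      and F: "\<forall>i<N. cmod ((A_mat N *\<^sub>v v + (- z) \<cdot>\<^sub>v v) $ i) \<le> F"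
    have F': "cmod ((w + 1 / w) * padded v j - padded v (j - 1) - padded v (j + 1)) \<le> F"
      if j: "1 \<le> j" "j < N + 1" for j
    proof -
      obtain i where i: "j = Suc i" "i < N" using j by (cases j) auto
      have "(A_mat N *\<^sub>v v + (- z) \<cdot>\<^sub>v v) $ i
          = (2 * padded v (Suc i) - padded v i - padded v (Suc (Suc i))) - z * padded v (Suc i)"
        using v i(2) carrier_matD [OF A_mat_carrier, of N]
        by (simp add: A_mat_mult_vec [OF v i(2)] padded_Suc del: index_mult_mat_vec)
      also have "\<dots> = (w + 1 / w) * padded v j - padded v (j - 1) - padded v (j + 1)"
        by (simp add: z i(1) algebra_simps)
      finally show ?thesis using F i(2) by metis
    qed
    show "\<forall>i<N. cmod (v $ i) \<le> 1 / (1 - cmod w)\<^sup>2 * F"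
    proof (intro allI impI)
      fix i assume i: "i < N"
      have "cmod (padded v (Suc i)) \<le> F / (1 - cmod w)\<^sup>2"
        by (rule second_difference_resolvent_bound [OF w, of "N + 1"])
          (use v F0 F' i in \<open>auto simp: padded_def\<close>)
      then show "cmod (v $ i) \<le> 1 / (1 - cmod w)\<^sup>2 * F" using v i by (simp add: padded_Suc)
    qed
  qed
qed

text \<open>By the fundamental theorem of algebra the resolvent bounds multiply along the linear factors of
  \<open>Q\<close>. The number of factors is fixed, so the constant does not depend on \<open>N\<close>.\<close>

lemma poly_mat_inverse_bound:
  fixes Q :: "complex poly"
  assumes "\<forall>x::real \<in> {0..4}. poly Q (complex_of_real x) \<noteq> 0"
  shows "\<exists>C>0. \<forall>N. \<forall>v \<in> carrier_vec N. \<forall>F\<ge>0.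
    (\<forall>i<N. cmod ((poly_mat Q (A_mat N) *\<^sub>v v) $ i) \<le> F) \<longrightarrow> (\<forall>i<N. cmod (v $ i) \<le> C * F)"
  using assms
proof (induction "degree Q" arbitrary: Q)
  case 0
  obtain c where Q: "Q = [:c:]" using 0(1) [symmetric] by (rule degree_eq_zeroE)
  have c: "c \<noteq> 0" using 0(2) [rule_format, of 0] by (simp add: Q)
  have "(poly_mat Q (A_mat N) *\<^sub>v v) $ i = c * v $ i" if "v \<in> carrier_vec N" "i < N" for N v i
  proof -
    have "poly_mat Q (A_mat N) = c \<cdot>\<^sub>m 1\<^sub>m N"
      by (rule eq_matI) (auto simp: Q poly_mat_def A_mat_def)
    then show ?thesis using that by simp
  qed
  then show ?case
    using c by (intro exI [of _ "1 / cmod c"]) (auto simp: norm_mult field_simps)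
next
  case (Suc d)
  have "\<not> constant (poly Q)" using Suc(2) by (simp add: constant_degree)
  then obtain z where z: "poly Q z = 0"
    using fundamental_theorem_of_algebra by blast
  then obtain R where Q: "Q = [:-z, 1:] * R" unfolding poly_eq_0_iff_dvd by (rule dvdE)
  have "R \<noteq> 0" using Q Suc(2) by (metis degree_0 mult_zero_right nat.distinct(1))
  then have "degree Q = 1 + degree R" unfolding Q by (subst degree_mult_eq) auto
  then have "d = degree R" using Suc(2) by simp
  moreover have "\<forall>x::real \<in> {0..4}. poly R (complex_of_real x) \<noteq> 0" using Suc(3) Q by auto
  ultimately obtain C where C: "C > 0" "\<forall>N. \<forall>v \<in> carrier_vec N. \<forall>F\<ge>0.
    (\<forall>i<N. cmod ((poly_mat R (A_mat N) *\<^sub>v v) $ i) \<le> F) \<longrightarrow> (\<forall>i<N. cmod (v $ i) \<le> C * F)"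
    using Suc(1) by blast
  have "\<forall>x::real \<in> {0..4}. z \<noteq> complex_of_real x" using Suc(3) z by auto
  then obtain B where B: "B > 0" "\<And>N v F. v \<in> carrier_vec N \<Longrightarrow> F \<ge> 0 \<Longrightarrow>
       (\<forall>i<N. cmod ((A_mat N *\<^sub>v v + (- z) \<cdot>\<^sub>v v) $ i) \<le> F) \<Longrightarrow> (\<forall>i<N. cmod (v $ i) \<le> B * F)"
    using resolvent_bound [of z] by blast
  show ?case
  proof (intro exI [of _ "C * B"] conjI allI ballI impI)
    show "C * B > 0" using B C by simp
    fix N v and F :: real and i
    assume v: "v \<in> carrier_vec N" and F0: "F \<ge> 0" and i: "i < N"
      and F: "\<forall>i<N. cmod ((poly_mat Q (A_mat N) *\<^sub>v v) $ i) \<le> F"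
    define y where "y = poly_mat R (A_mat N) *\<^sub>v v"
    have y: "y \<in> carrier_vec N"
      using v poly_mat_carrier [OF A_mat_carrier, of R N] unfolding y_def by simp
    have "\<forall>i<N. cmod (y $ i) \<le> B * F"
      using B(2) [OF y F0] F unfolding Q poly_mat_linear_mult_vec [OF A_mat_carrier v] y_def
      by blast
    then have "\<forall>i<N. cmod (v $ i) \<le> C * (B * F)"
      using C(2) v F0 B(1) unfolding y_def by simp
    then show "cmod (v $ i) \<le> C * B * F" using i by (simp add: mult.assoc)
  qed
qed

section \<open>Inverting the discrete Laplacian\<close>

text \<open>At the leftmost point where a negative minimum is attained, the left neighbour would be strictly
  larger and the right neighbour no smaller, against superharmonicity.\<close>

lemma discrete_minimum_principle:
  fixes a :: "nat \<Rightarrow> real"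
  assumes bdry: "a 0 \<ge> 0" "a n \<ge> 0"
    and super: "\<And>j. 1 \<le> j \<Longrightarrow> j < n \<Longrightarrow> a (j - 1) + a (j + 1) \<le> 2 * a j"
    and j: "j \<le> n"
  shows "a j \<ge> 0"
proof (rule ccontr)
  assume neg: "\<not> a j \<ge> 0"
  define m where "m = Min (a ` {0..n})"
  have m: "m \<le> a i" if "i \<le> n" for i unfolding m_def using that by (intro Min_le) auto
  have "m < 0" using m [OF j] neg by simp
  have "m \<in> a ` {0..n}" unfolding m_def by (rule Min_in) auto
  then have ex: "\<exists>i. i \<le> n \<and> a i = m" by auto
  define k where "k = (LEAST i. i \<le> n \<and> a i = m)"
  have k: "k \<le> n" "a k = m" using LeastI_ex [OF ex] unfolding k_def by auto
  have "k \<noteq> 0" "k \<noteq> n" using k(2) bdry \<open>m < 0\<close> by (metis not_le)+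
  then have k0: "1 \<le> k" "k < n" using k(1) by auto
  have "\<not> (k - 1 \<le> n \<and> a (k - 1) = m)"
    by (rule not_less_Least) (use k0 in \<open>simp add: k_def [symmetric]\<close>)
  then have "a (k - 1) > m" using m [of "k - 1"] k0 by (auto simp: less_le)
  moreover have "a (k + 1) \<ge> m" using m k0 by simp
  ultimately show False using super [OF k0] k(2) by simp
qed

text \<open>The comparison function is \<open>\<psi> = q + p\<close>. Its quadratic part \<open>q\<close> has negative second difference
  exactly \<open>1/n\<^sup>2\<close> and is bounded. For the entries near the ends, where the right-hand side need not be
  small, \<open>p\<close> is used: the negative second difference of \<open>1 - 2\<^sup>-\<^sup>j\<close> is \<open>2\<^sup>-\<^sup>j / 2\<close>, so the factor
  \<open>2\<^sup>r\<^sup>+\<^sup>1\<close> makes it at least \<open>1\<close> for \<open>j \<le> r\<close>, and the reflected term does the same at the other end.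
  Since \<open>\<bar>x\<bar>\<close> is subharmonic up to the size of the right-hand side, \<open>M \<psi> - \<bar>x\<bar>\<close> is superharmonic and
  the minimum principle gives \<open>\<bar>x\<bar> \<le> M \<psi>\<close>.\<close>

lemma discrete_Laplacian_bound:
  fixes x :: "nat \<Rightarrow> complex"
  assumes n: "n \<ge> 1" and bdry: "x 0 = 0" "x n = 0" and M: "M \<ge> 0"
    and f: "\<And>j. 1 \<le> j \<Longrightarrow> j < n \<Longrightarrow> cmod (2 * x j - x (j - 1) - x (j + 1))
      \<le> (if r < j \<and> j < n - r then M / (real n)\<^sup>2 else M)"
    and j: "j \<le> n"
  shows "cmod (x j) \<le> (1 + 2 ^ (r + 2)) * M"
proof -
  define q where "q j = real j * (real n - real j) / (2 * (real n)\<^sup>2)" for j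
  define p :: "nat \<Rightarrow> real" where "p j = 2 ^ (r + 1) * (2 - (1/2) ^ j - (1/2) ^ (n - j))" for j
  define \<psi> where "\<psi> j = q j + p j" for j
  have \<psi>_step: "2 * \<psi> j - \<psi> (j - 1) - \<psi> (j + 1)
      = 1 / (real n)\<^sup>2 + 2 ^ r * ((1/2) ^ j + (1/2) ^ (n - j))" if j: "1 \<le> j" "j < n" for j
  proof -
    obtain i where i: "j = Suc i" using j(1) by (cases j) auto
    obtain k where k: "n = Suc (Suc (i + k))"
      using j(2) unfolding i less_iff_Suc_add by auto
    have e: "n - j = Suc k" "n - (j - 1) = Suc (Suc k)" "n - (j + 1) = k" using i k by auto
    have nr: "real n \<noteq> 0" using n by simp
    have "2 * q j - q (j - 1) - q (j + 1) = 1 / (real n)\<^sup>2"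
      using nr by (simp add: q_def i field_simps)
    moreover have "2 * p j - p (j - 1) - p (j + 1) = 2 ^ r * ((1/2) ^ j + (1/2) ^ (n - j))"
      unfolding p_def e by (simp add: i algebra_simps)
    moreover have "2 * \<psi> j - \<psi> (j - 1) - \<psi> (j + 1)
        = (2 * q j - q (j - 1) - q (j + 1)) + (2 * p j - p (j - 1) - p (j + 1))"
      by (simp add: \<psi>_def)
    ultimately show ?thesis by (simp only:)
  qed
  have pow1: "(1/2::real) ^ k \<le> 1" for k by (simp add: power_le_one)
  have f_le_\<psi>: "cmod (2 * x j - x (j - 1) - x (j + 1)) \<le> M * (2 * \<psi> j - \<psi> (j - 1) - \<psi> (j + 1))"
    if j: "1 \<le> j" "j < n" for j
  proof -
    have one: "2 ^ r * (1/2::real) ^ k \<ge> 1" if "k \<le> r" for k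
    proof -
      have "2 ^ r * (1/2::real) ^ k = 2 ^ (r - k)"
        using that by (simp add: power_diff field_simps power_one_over)
      then show ?thesis by simp
    qed
    have "(if r < j \<and> j < n - r then 1 / (real n)\<^sup>2 else 1)
        \<le> 1 / (real n)\<^sup>2 + 2 ^ r * ((1/2) ^ j + (1/2) ^ (n - j))"
    proof (cases "r < j \<and> j < n - r")
      case True
      then show ?thesis by simp
    next
      case False
      then have "j \<le> r \<or> n - j \<le> r" by auto
      then have "1 \<le> 2 ^ r * (1/2::real) ^ j + 2 ^ r * (1/2) ^ (n - j)"
        using one [of j] one [of "n - j"]
        by (auto intro: add_increasing add_increasing2)
      then have "1 \<le> 1 / (real n)\<^sup>2 + (2 ^ r * (1/2::real) ^ j + 2 ^ r * (1/2) ^ (n - j))"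
        by (rule add_increasing [rotated]) simp
      then show ?thesis using False by (auto simp: distrib_left)
    qed
    then have "M * (if r < j \<and> j < n - r then 1 / (real n)\<^sup>2 else 1)
        \<le> M * (2 * \<psi> j - \<psi> (j - 1) - \<psi> (j + 1))"
      unfolding \<psi>_step [OF j] using M by (rule mult_left_mono)
    then show ?thesis using f [OF j] by (auto split: if_splits)
  qed
  have "M * \<psi> j - cmod (x j) \<ge> 0"
  proof (rule discrete_minimum_principle [where n = n and a = "\<lambda>j. M * \<psi> j - cmod (x j)"])
    show "M * \<psi> 0 - cmod (x 0) \<ge> 0" "M * \<psi> n - cmod (x n) \<ge> 0"
      using bdry M pow1 [of n] by (auto simp: \<psi>_def q_def p_def)
    show "(M * \<psi> (j - 1) - cmod (x (j - 1))) + (M * \<psi> (j + 1) - cmod (x (j + 1)))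
        \<le> 2 * (M * \<psi> j - cmod (x j))" if j: "1 \<le> j" "j < n" for j
    proof -
      have "2 * cmod (x j) = cmod ((2 * x j - x (j - 1) - x (j + 1)) + x (j - 1) + x (j + 1))"
        by (simp add: norm_mult)
      also have "\<dots> \<le> cmod (2 * x j - x (j - 1) - x (j + 1)) + cmod (x (j - 1)) + cmod (x (j + 1))"
        by (intro order_trans [OF norm_triangle_ineq] add_mono norm_triangle_ineq order_refl)
      finally show ?thesis using f_le_\<psi> [OF j] by (simp add: algebra_simps)
    qed
  qed (rule j)
  moreover have "\<psi> j \<le> 1 + 2 ^ (r + 2)"
  proof -
    have "real j * (real n - real j) \<le> real n * real n" using j by (intro mult_mono) auto
    also have "\<dots> \<le> 2 * (real n)\<^sup>2" by (simp add: power2_eq_square)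
    finally have "q j \<le> 1"
      unfolding q_def by (rule divide_le_eq_1_pos [THEN iffD2, rotated]) (use n in simp)
    moreover have "p j \<le> 2 ^ (r + 1) * 2"
    proof -
      have "0 \<le> (1/2::real) ^ j" "0 \<le> (1/2::real) ^ (n - j)" by simp_all
      then have "2 - (1/2) ^ j - (1/2) ^ (n - j) \<le> (2::real)" by linarith
      then show ?thesis unfolding p_def by (rule mult_left_mono) simp
    qed
    ultimately show ?thesis unfolding \<psi>_def by simp
  qed
  then have "M * \<psi> j \<le> M * (1 + 2 ^ (r + 2))" using M by (rule mult_left_mono)
  ultimately show ?thesis by (simp add: mult.commute)
qed

section \<open>Strong stability\<close>

text \<open>With \<open>y = Q(A\<^sub>N) v\<close> and \<open>n = N + 1\<close>, the weights say that \<open>A\<^sub>N y\<close> has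
  exactly the two-scale size that \<open>discrete_Laplacian_bound\<close> admits. The resulting bound on \<open>y\<close> is the
  input of \<open>poly_mat_inverse_bound\<close>.\<close>

theorem theorem4p1:
  fixes P :: "complex poly"
  assumes "poly P 0 = 0"
    and "poly (pderiv P) 0 \<noteq> 0"
    and "\<forall>x::real \<in> {0<..4}. poly P (complex_of_real x) \<noteq> 0"
  shows "strongly_stable (\<lambda>N. poly_mat P (A_mat N))"
proof -
  obtain Q where P: "P = [:0, 1:] * Q"
    using assms(1) by (metis dvdE minus_zero poly_eq_0_iff_dvd)
  have "poly Q 0 \<noteq> 0" using assms(2) by (simp add: P pderiv_mult pderiv_pCons)
  then have "\<forall>x::real \<in> {0..4}. poly Q (complex_of_real x) \<noteq> 0"
    using assms(3) unfolding P by (auto simp: order.order_iff_strict)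
  then obtain C where C: "C > 0" "\<forall>N. \<forall>v \<in> carrier_vec N. \<forall>F\<ge>0.
    (\<forall>i<N. cmod ((poly_mat Q (A_mat N) *\<^sub>v v) $ i) \<le> F) \<longrightarrow> (\<forall>i<N. cmod (v $ i) \<le> C * F)"
    using poly_mat_inverse_bound by blast
  show ?thesis
    unfolding strongly_stable_def
  proof (intro conjI allI impI)
    show "poly_mat P (A_mat N) \<in> carrier_mat N N" for N by (intro poly_mat_carrier A_mat_carrier)
    fix r :: nat
    define K :: real where "K = C * (1 + 2 ^ (r + 2))"
    have K: "K > 0" using C by (simp add: K_def add_pos_pos)
    show "\<exists>c>0. \<forall>N\<ge>1. \<forall>v \<in> carrier_vec N. c * sup_norm_vec v
      \<le> Max ((\<lambda>j. weight N r j * cmod ((poly_mat P (A_mat N) *\<^sub>v v) $ (j - 1))) ` {1..N})"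
    proof (intro exI [of _ "1 / K"] conjI allI impI ballI)
      show "1 / K > 0" using K by simp
      fix N :: nat and v :: "complex vec"
      assume N: "N \<ge> 1" and v: "v \<in> carrier_vec N"
      define f where "f = poly_mat P (A_mat N) *\<^sub>v v"
      define M where "M = Max ((\<lambda>j. weight N r j * cmod (f $ (j - 1))) ` {1..N})"
      define y where "y = poly_mat Q (A_mat N) *\<^sub>v v"
      have y: "y \<in> carrier_vec N"
        using v poly_mat_carrier [OF A_mat_carrier, of Q N] unfolding y_def by simp
      have f: "f = A_mat N *\<^sub>v y"
        unfolding f_def P poly_mat_linear_mult_vec [OF A_mat_carrier v] y_def [symmetric]
        using y carrier_matD [OF A_mat_carrier, of N] by (intro eq_vecI) auto
      have wM: "weight N r j * cmod (f $ (j - 1)) \<le> M" if "1 \<le> j" "j \<le> N" for j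
        unfolding M_def using that by (intro Max_ge) auto
      have "weight N r 1 \<ge> 0" by (simp add: weight_def mesh_width_def)
      then have M0: "M \<ge> 0"
        using wM [of 1] N by (meson mult_nonneg_nonneg norm_ge_zero order_refl order_trans)
      have fM: "cmod (2 * padded y j - padded y (j - 1) - padded y (j + 1))
          \<le> (if r < j \<and> j < N + 1 - r then M / (real (N + 1))\<^sup>2 else M)"
        if j: "1 \<le> j" "j < N + 1" for j
      proof -
        obtain i where i: "j = Suc i" "i < N" using j by (cases j) auto
        have "2 * padded y j - padded y (j - 1) - padded y (j + 1) = f $ (j - 1)"
          using A_mat_mult_vec [OF y i(2)] by (simp add: f i(1))
        then have "cmod (2 * padded y j - padded y (j - 1) - padded y (j + 1)) = cmod (f $ (j - 1))"
        by simp
      moreover have "weight N r j = (if r < j \<and> j < N + 1 - r then (real (N + 1))\<^sup>2 else 1)"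
          by (simp add: weight_def mesh_width_def power_int_minus field_simps)
        ultimately show ?thesis
          using wM [of j] j by (auto simp: pos_le_divide_eq mult.commute)
      qed
      have "cmod (y $ i) \<le> (1 + 2 ^ (r + 2)) * M" if i: "i < N" for i
      proof -
        have "cmod (padded y (Suc i)) \<le> (1 + 2 ^ (r + 2)) * M"
          by (rule discrete_Laplacian_bound [of "N + 1", OF _ _ _ M0 fM])
            (use y i in \<open>auto simp: padded_def\<close>)
        then show ?thesis using y i by (simp add: padded_Suc)
      qed
      then have "\<forall>i<N. cmod (v $ i) \<le> C * ((1 + 2 ^ (r + 2)) * M)"
        using C(2) v M0 unfolding y_def by simp
      then have "sup_norm_vec v \<le> K * M"
        unfolding sup_norm_vec_def using N v by (subst Max_le_iff) (auto simp: K_def mult.assoc)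
      then show "1 / K * sup_norm_vec v
          \<le> Max ((\<lambda>j. weight N r j * cmod ((poly_mat P (A_mat N) *\<^sub>v v) $ (j - 1))) ` {1..N})"
        using K unfolding M_def f_def by (simp add: field_simps)
    qed
  qed
qed

end
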